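(* For every increasing function $\mu:\mathbb N\to\mathbb R_+$ with $\mu(n)=o(n)$, there exists a finitely generated group $\Gamma$ and a finite generating set $S$ of $\Gamma$ such that $$\gamma_\Gamma^S(n)<\exp\bigl(n^{4/5}\bigr)\quad\text{for infinitely many } n\in\mathbb N,$$ and $$\gamma_\Gamma^S(n')>\exp\bigl(\mu(n')\bigr)\quad\text{for infinitely many } n'\in\mathbb N.$$
   Context: For a group $\Gamma$ with finite symmetric generating set $S$, $\gamma_\Gamma^S(n)$ is the number of elements of $\Gamma$ of word length at most $n$ with respect to $S$. *)

theory Defs
  imports Complex_Main "HOL-Algebra.Generated_Groups" "HOL-Library.Landau_Symbols"
begin

definition finite_symmetric_generating_set :: "('a, 'b) monoid_scheme \<Rightarrow> 'a set \<Rightarrow> bool" where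
  "finite_symmetric_generating_set G S \<longleftrightarrow>
     finite S \<and> S \<subseteq> carrier G \<and> (\<forall>s\<in>S. inv\<^bsub>G\<^esub> s \<in> S) \<and> generate G S = carrier G"

(* The least length of a word over S representing g.  Words use the letters of S only, which is
   the usual word length when S is symmetric.  For g not representable by a word over S the value
   is unspecified; this does not occur when S is a symmetric generating set. *)
definition word_length :: "('a, 'b) monoid_scheme \<Rightarrow> 'a set \<Rightarrow> 'a \<Rightarrow> nat" where
  "word_length G S g =
     (LEAST k. \<exists>ws. set ws \<subseteq> S \<and> length ws = k \<and> foldr (\<otimes>\<^bsub>G\<^esub>) ws \<one>\<^bsub>G\<^esub> = g)"

definition growth :: "('a, 'b) monoid_scheme \<Rightarrow> 'a set \<Rightarrow> nat \<Rightarrow> nat" where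
  "growth G S n = card {g \<in> carrier G. word_length G S g \<le> n}"

end

theory Submission
  imports Defs "HOL-Library.Countable_Set"
begin

text \<open>The group is a Grigorchuk-type group acting on the binary tree, governed by a sequence
  \<open>\<omega>\<close> of booleans that consists of ever longer constant stretches.  A stretch of \<open>j\<close> true entries
  starting at level \<open>k\<close> contracts the total weight of the sections by \<open>5/6\<close> per level; since there
  are \<open>2 ^ (k + j)\<close> sections at the end of the stretch, an element of length \<open>n \<le> (12/5) ^ j\<close> is
  described by \<open>O(2 ^ (k + j))\<close> symbols, and \<open>2 < (12/5) powr (4/5)\<close> makes the ball of radius
  \<open>n = \<lfloor>(12/5) ^ j\<rfloor>\<close> small once \<open>j\<close> is large.  During a stretch of \<open>m\<close> false entries starting at
  level \<open>k\<close> the group looks like a lamplighter group up to that depth, so that the ball of radius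
  \<open>3 ^ k * 2 * 2 ^ m\<close> has at least \<open>2 ^ 2 ^ m\<close> elements, which exceeds \<open>exp \<circ> \<mu>\<close> once \<open>m\<close> is
  large.\<close>

section \<open>Words acting on the binary tree\<close>

datatype letter = A | B | C | D

lemma UNIV_letter: "(UNIV :: letter set) = {A, B, C, D}"
  by (auto intro: letter.exhaust)

instance letter :: finite
  by standard (simp add: UNIV_letter)

fun rot :: "letter \<Rightarrow> letter" where
  "rot A = A" | "rot B = C" | "rot C = D" | "rot D = B"

fun unrot :: "letter \<Rightarrow> letter" where
  "unrot A = A" | "unrot B = D" | "unrot C = B" | "unrot D = C"

definition letter_section :: "bool \<Rightarrow> letter \<Rightarrow> bool \<Rightarrow> letter list" where
  "letter_section r s x =
     (if s = A then [] else if x then [if r then rot s else s] else if s = D then [] else [A])"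

primrec swaps :: "letter list \<Rightarrow> bool" where
  "swaps [] = False"
| "swaps (s # w) = ((s = A) \<noteq> swaps w)"

primrec sec :: "bool \<Rightarrow> letter list \<Rightarrow> bool \<Rightarrow> letter list" where
  "sec r [] x = []"
| "sec r (s # w) x = letter_section r s (x \<noteq> swaps w) @ sec r w x"

abbreviation shift :: "(nat \<Rightarrow> bool) \<Rightarrow> nat \<Rightarrow> bool" where
  "shift \<omega> \<equiv> \<lambda>i. \<omega> (Suc i)"

text \<open>The letters are the generators of a Grigorchuk-type group: \<open>A\<close> swaps the two subtrees, and
  \<open>B = (A, \<pi> B)\<close>, \<open>C = (A, \<pi> C)\<close>, \<open>D = (1, \<pi> D)\<close>, where at level \<open>i\<close> the permutation \<open>\<pi>\<close> is the
  3-cycle \<open>rot\<close> if \<open>\<omega> i\<close> holds and the identity otherwise.  The rightmost letter of a word acts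
  first.\<close>

primrec act :: "(nat \<Rightarrow> bool) \<Rightarrow> letter list \<Rightarrow> bool list \<Rightarrow> bool list" where
  "act_Nil": "act \<omega> w [] = []"
| "act_Cons": "act \<omega> w (x # v) = (x \<noteq> swaps w) # act (shift \<omega>) (sec (\<omega> 0) w x) v"


section \<open>Composition of words and the relations among the letters\<close>

lemma swaps_append [simp]: "swaps (u @ w) = (swaps u \<noteq> swaps w)"
  by (induction u) auto

lemma sec_append [simp]: "sec r (u @ w) x = sec r u (x \<noteq> swaps w) @ sec r w x"
  by (induction u) (auto simp: letter_section_def)

lemma act_empty [simp]: "act \<omega> [] v = v"
  by (induction v arbitrary: \<omega>) auto

lemma act_append: "act \<omega> (u @ w) v = act \<omega> u (act \<omega> w v)"
proof (induction v arbitrary: \<omega> u w)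
  case (Cons x v)
  then show ?case
    by (cases x; cases "swaps u"; cases "swaps w") simp_all
qed simp

lemma act_double [simp]: "act \<omega> [s, s] v = v"
proof (induction v arbitrary: \<omega> s)
  case (Cons x v)
  then show ?case
    by (cases "s = A") (auto simp: letter_section_def)
qed simp

text \<open>The value \<open>A\<close> is a mere filler outside pairs of distinct letters other than
  \<open>A\<close>.\<close>

fun third :: "letter \<Rightarrow> letter \<Rightarrow> letter" where
  "third B C = D" | "third C B = D" | "third B D = C" | "third D B = C"
| "third C D = B" | "third D C = B" | "third s t = A"

text \<open>\<open>B\<close>, \<open>C\<close>, \<open>D\<close> multiply as in a Klein four-group.
  Rotating them preserves this rule at \<open>True\<close>; at \<open>False\<close> two of them
  become \<open>A\<close> and the third becomes trivial, so only \<open>act_double\<close> is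
  needed.\<close>

lemma act_third:
  assumes "s \<noteq> A" "t \<noteq> A" "s \<noteq> t"
  shows "act \<omega> [s, t] v = act \<omega> [third s t] v"
  using assms
proof (induction v arbitrary: \<omega> s t)
  case (Cons x v)
  show ?case
    using Cons.prems
    by (cases s; cases t; cases x; cases "\<omega> 0") (auto simp: letter_section_def Cons.IH)
qed simp

section \<open>The groups and their growth\<close>

text \<open>There are countably many words, so their actions can be numbered; this puts the carrier
  into \<open>nat\<close> without normal forms.\<close>

definition element :: "(nat \<Rightarrow> bool) \<Rightarrow> letter list \<Rightarrow> nat" where
  "element \<omega> w = to_nat_on (range (act \<omega>)) (act \<omega> w)"

definition tree_group :: "(nat \<Rightarrow> bool) \<Rightarrow> nat monoid" where
  "tree_group \<omega> =
     \<lparr>carrier = range (element \<omega>),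
      mult = (\<lambda>x y. element \<omega> (inv_into UNIV (element \<omega>) x @ inv_into UNIV (element \<omega>) y)),
      one = element \<omega> []\<rparr>"

definition gens :: "(nat \<Rightarrow> bool) \<Rightarrow> nat set" where
  "gens \<omega> = range (\<lambda>s. element \<omega> [s])"

definition ball :: "(nat \<Rightarrow> bool) \<Rightarrow> nat \<Rightarrow> (bool list \<Rightarrow> bool list) set" where
  "ball \<omega> n = act \<omega> ` {w. length w \<le> n}"

lemma finite_words: "finite {w :: letter list. length w \<le> n}"
  using finite_lists_length_le[of "UNIV :: letter set" n] by simp

lemma element_eq_iff: "element \<omega> u = element \<omega> w \<longleftrightarrow> act \<omega> u = act \<omega> w"
proof -
  have "countable (range (act \<omega>))"
    by simp
  then show ?thesis
    unfolding element_def by (simp add: inj_on_eq_iff[OF inj_on_to_nat_on])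
qed

lemma element_eqI: "(\<And>v. act \<omega> u v = act \<omega> w v) \<Longrightarrow> element \<omega> u = element \<omega> w"
  by (simp add: element_eq_iff fun_eq_iff)

lemma mult_element: "element \<omega> u \<otimes>\<^bsub>tree_group \<omega>\<^esub> element \<omega> w = element \<omega> (u @ w)"
proof -
  have "act \<omega> (inv_into UNIV (element \<omega>) (element \<omega> z)) = act \<omega> z" for z
    by (rule iffD1[OF element_eq_iff]) (simp add: f_inv_into_f)
  then show ?thesis
    by (simp add: tree_group_def element_eq_iff act_append fun_eq_iff)
qed

lemma one_element: "\<one>\<^bsub>tree_group \<omega>\<^esub> = element \<omega> []"
  by (simp add: tree_group_def)

lemma carrier_element: "carrier (tree_group \<omega>) = range (element \<omega>)"
  by (simp add: tree_group_def)

lemma act_rev: "act \<omega> (rev w @ w) v = v"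
proof (induction w)
  case (Cons s w)
  have "act \<omega> (rev (s # w) @ s # w) v = act \<omega> (rev w @ [s, s] @ w) v"
    by simp
  also have "\<dots> = act \<omega> (rev w @ w) v"
    by (simp only: act_append act_double)
  finally show ?case
    using Cons by simp
qed simp

lemma group_tree_group: "group (tree_group \<omega>)"
proof (rule groupI)
  fix x assume "x \<in> carrier (tree_group \<omega>)"
  then obtain w where x: "x = element \<omega> w"
    by (auto simp: carrier_element)
  have "element \<omega> (rev w) \<otimes>\<^bsub>tree_group \<omega>\<^esub> x = \<one>\<^bsub>tree_group \<omega>\<^esub>"
    unfolding x mult_element one_element by (rule element_eqI) (simp add: act_rev)
  then show "\<exists>y\<in>carrier (tree_group \<omega>). y \<otimes>\<^bsub>tree_group \<omega>\<^esub> x = \<one>\<^bsub>tree_group \<omega>\<^esub>"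
    by (auto simp: carrier_element)
qed (auto simp: carrier_element one_element mult_element)

lemma foldr_gens:
  "foldr (\<otimes>\<^bsub>tree_group \<omega>\<^esub>) (map (\<lambda>s. element \<omega> [s]) w) \<one>\<^bsub>tree_group \<omega>\<^esub> = element \<omega> w"
  by (induction w) (simp_all add: one_element mult_element)

lemma gens_generate: "finite_symmetric_generating_set (tree_group \<omega>) (gens \<omega>)"
proof -
  interpret group "tree_group \<omega>"
    by (rule group_tree_group)
  have sub: "gens \<omega> \<subseteq> carrier (tree_group \<omega>)"
    by (auto simp: gens_def carrier_element)
  have "element \<omega> [s] \<otimes>\<^bsub>tree_group \<omega>\<^esub> element \<omega> [s] = \<one>\<^bsub>tree_group \<omega>\<^esub>" for s
    unfolding mult_element one_element by (rule element_eqI) simp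
  then have "inv\<^bsub>tree_group \<omega>\<^esub> (element \<omega> [s]) = element \<omega> [s]" for s
    using inv_equality by (auto simp: carrier_element)
  then have "\<forall>x\<in>gens \<omega>. inv\<^bsub>tree_group \<omega>\<^esub> x \<in> gens \<omega>"
    by (auto simp: gens_def)
  moreover have "element \<omega> w \<in> generate (tree_group \<omega>) (gens \<omega>)" for w
  proof (induction w)
    case Nil
    then show ?case
      using generate.one[of "tree_group \<omega>"] by (simp add: one_element)
  next
    case (Cons s w)
    have "element \<omega> [s] \<in> generate (tree_group \<omega>) (gens \<omega>)"
      by (auto intro: generate.incl simp: gens_def)
    from generate.eng[OF this Cons] show ?case
      by (simp add: mult_element)
  qed
  then have "generate (tree_group \<omega>) (gens \<omega>) = carrier (tree_group \<omega>)"
    using generate_incl[OF sub] by (auto simp: carrier_element)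
  ultimately show ?thesis
    using sub by (simp add: finite_symmetric_generating_set_def gens_def)
qed

lemma word_length_le_iff:
  assumes "g \<in> carrier (tree_group \<omega>)"
  shows "word_length (tree_group \<omega>) (gens \<omega>) g \<le> n \<longleftrightarrow> (\<exists>w. length w \<le> n \<and> element \<omega> w = g)"
proof -
  let ?prod = "\<lambda>ws. foldr (\<otimes>\<^bsub>tree_group \<omega>\<^esub>) ws \<one>\<^bsub>tree_group \<omega>\<^esub>"
  define P where "P = (\<lambda>k. \<exists>ws. set ws \<subseteq> gens \<omega> \<and> length ws = k \<and> ?prod ws = g)"
  have P_iff: "P k \<longleftrightarrow> (\<exists>w. length w = k \<and> element \<omega> w = g)" for k
  proof -
    have sub_iff: "set ws \<subseteq> gens \<omega> \<longleftrightarrow> (\<exists>w. ws = map (\<lambda>s. element \<omega> [s]) w)" for ws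
      unfolding ex_map_conv gens_def by blast
    have "P k \<longleftrightarrow> (\<exists>w. length (map (\<lambda>s. element \<omega> [s]) w) = k \<and> ?prod (map (\<lambda>s. element \<omega> [s]) w) = g)"
      unfolding P_def sub_iff by blast
    then show ?thesis
      unfolding foldr_gens length_map .
  qed
  obtain w where "element \<omega> w = g"
    using assms unfolding carrier_element by blast
  then have "P (length w)"
    unfolding P_iff by blast
  then have least: "P (Least P)"
    by (rule LeastI)
  have "Least P \<le> n \<longleftrightarrow> (\<exists>k\<le>n. P k)"
    using least Least_le[of P] le_trans by blast
  then show ?thesis
    unfolding word_length_def P_def[symmetric] P_iff by blast
qed

lemma growth_eq_card_ball: "growth (tree_group \<omega>) (gens \<omega>) n = card (ball \<omega> n)"
proof -
  have "{g \<in> carrier (tree_group \<omega>). word_length (tree_group \<omega>) (gens \<omega>) g \<le> n}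
      = element \<omega> ` {w. length w \<le> n}"
    by (auto simp: word_length_le_iff carrier_element intro: image_eqI[OF sym])
  also have "\<dots> = to_nat_on (range (act \<omega>)) ` ball \<omega> n"
    by (simp add: ball_def image_image element_def)
  also have "card \<dots> = card (ball \<omega> n)"
    by (intro card_image inj_on_subset[OF inj_on_to_nat_on[of "range (act \<omega>)"]])
       (auto simp: ball_def)
  finally show ?thesis
    by (simp add: growth_def)
qed

section \<open>Upper bound: stretches of rotations\<close>

fun weight :: "letter \<Rightarrow> nat" where
  "weight A = 7" | "weight B = 8" | "weight C = 5" | "weight D = 3"

abbreviation weights :: "letter list \<Rightarrow> nat" where
  "weights w \<equiv> sum_list (map weight w)"

section \<open>Reduction of words to alternating form\<close>

definition alternating :: "letter list \<Rightarrow> bool" where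
  "alternating = successively (\<lambda>s t. s = A \<longleftrightarrow> t \<noteq> A)"

definition cons_reduced :: "letter \<Rightarrow> letter list \<Rightarrow> letter list" where
  "cons_reduced s w = (case w of [] \<Rightarrow> [s] | t # u \<Rightarrow>
     if s = t then u else if s \<noteq> A \<and> t \<noteq> A then third s t # u else s # w)"

definition reduce :: "letter list \<Rightarrow> letter list" where
  "reduce w = foldr cons_reduced w []"

lemma act_cons_reduced: "act \<omega> (cons_reduced s w) v = act \<omega> (s # w) v"
proof (cases w)
  case (Cons t u)
  have *: "act \<omega> (s # t # u) v = act \<omega> [s, t] (act \<omega> u v)"
    using act_append[of \<omega> "[s, t]" u v] by simp
  have **: "act \<omega> (third s t # u) v = act \<omega> [third s t] (act \<omega> u v)"
    using act_append[of \<omega> "[third s t]" u v] by simp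
  have "act \<omega> [s, t] (act \<omega> u v) = act \<omega> [third s t] (act \<omega> u v)"
    if "s \<noteq> A" "t \<noteq> A" "s \<noteq> t"
    using that by (rule act_third)
  with Cons show ?thesis
    by (auto simp: cons_reduced_def * ** simp del: act_Cons)
qed (simp add: cons_reduced_def)

text \<open>The weights of \<open>B\<close>, \<open>C\<close>, \<open>D\<close> obey the triangle
  inequality for \<open>third\<close>, tight in \<open>8 = 5 + 3\<close>.\<close>

lemma weights_cons_reduced: "weights (cons_reduced s w) \<le> weights (s # w)"
proof (cases w)
  case (Cons t u)
  then show ?thesis
    by (cases s; cases t) (auto simp: cons_reduced_def)
qed (simp add: cons_reduced_def)

lemma third_eq_A_iff: "third s t = A \<longleftrightarrow> s = t \<or> s = A \<or> t = A"
  by (cases s; cases t) auto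

lemma alternating_cons_reduced: "alternating w \<Longrightarrow> alternating (cons_reduced s w)"
proof (cases w)
  case (Cons t u)
  assume "alternating w"
  with Cons show ?thesis
    by (cases u) (auto simp: cons_reduced_def alternating_def third_eq_A_iff)
qed (simp add: cons_reduced_def alternating_def)

lemma act_reduce: "act \<omega> (reduce w) = act \<omega> w"
proof
  fix v
  show "act \<omega> (reduce w) v = act \<omega> w v"
  proof (induction w)
    case (Cons s w)
    have "act \<omega> (reduce (s # w)) v = act \<omega> [s] (act \<omega> (reduce w) v)"
      using act_append[of \<omega> "[s]" "reduce w" v]
      by (simp add: reduce_def act_cons_reduced del: act_Cons)
    also have "\<dots> = act \<omega> (s # w) v"
      using act_append[of \<omega> "[s]" w v] by (simp add: Cons)
    finally show ?case .
  qed (simp add: reduce_def)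
qed

lemma weights_reduce: "weights (reduce w) \<le> weights w"
proof (induction w)
  case (Cons s w)
  have "weights (reduce (s # w)) \<le> weights (s # reduce w)"
    by (simp add: reduce_def weights_cons_reduced del: list.map sum_list.Cons)
  with Cons show ?case
    by simp
qed (simp add: reduce_def)

lemma alternating_reduce: "alternating (reduce w)"
  by (induction w) (simp_all add: reduce_def alternating_cons_reduced, simp add: alternating_def)

text \<open>The weights are chosen so that \<open>6 (weight A + weight (\<pi> B)) \<le> 5 (weight A + weight B)\<close> and
  likewise for the sections of \<open>C\<close> and \<open>D\<close>, \<open>\<pi>\<close> being the rotation: a weighted form, with rational
  weights, of Bartholdi's contraction estimate.\<close>

lemma weights_letter_section_rot:
  "s \<noteq> A \<Longrightarrow> 6 * (weights (letter_section True s False) + weights (letter_section True s True))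
     \<le> 5 * (weight s + 7)"
  by (cases s) (auto simp: letter_section_def)

lemma weights_letter_section_id:
  "s \<noteq> A \<Longrightarrow> weights (letter_section False s False) + weights (letter_section False s True)
     \<le> weight s + 7"
  by (cases s) (auto simp: letter_section_def)

text \<open>Letters \<open>A\<close> leave no trace in the sections, so every other letter can be
  charged together with the \<open>A\<close> on its left, of weight 7. A leading letter other than
  \<open>A\<close> lacks this partner, whence the extra 7.\<close>

lemma weights_sec_alternating:
  assumes contract: "\<And>s. s \<noteq> A \<Longrightarrow>
      a * (weights (letter_section r s False) + weights (letter_section r s True)) \<le> b * (weight s + 7)"
    and "alternating w"
  shows "a * (weights (sec r w False) + weights (sec r w True))
    \<le> b * (weights w + (if w = [] \<or> hd w = A then 0 else 7))"
  using assms(2)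
proof (induction w)
  case (Cons s w)
  let ?sum = "\<lambda>w. weights (sec r w False) + weights (sec r w True)"
  have alt: "alternating w" and hd: "w \<noteq> [] \<Longrightarrow> s = A \<longleftrightarrow> hd w \<noteq> A"
    using Cons.prems by (cases w; simp add: alternating_def)+
  show ?case
  proof (cases "s = A")
    case True
    have "a * ?sum (s # w) = a * ?sum w"
      using True by (simp add: letter_section_def)
    also have "\<dots> \<le> b * (weights w + 7)"
      using Cons.IH[OF alt] by (auto intro: order_trans split: if_splits)
    finally show ?thesis
      using True by (simp add: add.commute)
  next
    case False
    have "a * ?sum (s # w) = a * (weights (letter_section r s False) + weights (letter_section r s True)) + a * ?sum w"
      by (cases "swaps w") (simp_all add: algebra_simps)
    also have "\<dots> \<le> b * (weight s + 7) + b * weights w"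
      using Cons.IH[OF alt] contract[OF False] hd False by (intro add_mono) (auto split: if_splits)
    finally show ?thesis
      using False by (simp add: algebra_simps)
  qed
qed simp

lemma weights_sec_rot:
  assumes "alternating w"
  shows "6 * (weights (sec True w False) + weights (sec True w True)) \<le> 5 * (weights w + 7)"
  using weights_sec_alternating[OF weights_letter_section_rot assms] by (auto split: if_splits)

lemma weights_sec:
  assumes "alternating w"
  shows "weights (sec r w False) + weights (sec r w True) \<le> weights w + 7"
proof (cases r)
  case True
  then show ?thesis
    using weights_sec_rot[OF assms] by simp
next
  case False
  then show ?thesis
    using weights_sec_alternating[of 1 False 1, OF _ assms] weights_letter_section_id
    by (auto split: if_splits)
qed

text \<open>The portrait of depth \<open>j\<close>: swap bits at inner nodes and, at each of the
  \<open>2 ^ j\<close> leaves, a section spelled out and closed by \<open>Inr False\<close>.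
  Reducing before each split makes the estimate for alternating words apply at every level.\<close>

primrec encode :: "nat \<Rightarrow> (nat \<Rightarrow> bool) \<Rightarrow> letter list \<Rightarrow> (letter + bool) list" where
  "encode 0 \<omega> w = map Inl w @ [Inr False]"
| "encode (Suc j) \<omega> w =
     Inr (swaps (reduce w)) # encode j (shift \<omega>) (sec (\<omega> 0) (reduce w) False)
                            @ encode j (shift \<omega>) (sec (\<omega> 0) (reduce w) True)"

text \<open>The code is prefix-free, which lets the codes of the two sections be concatenated.\<close>

lemma encode_append_eqD:
  "encode j \<omega> u @ p = encode j \<omega> w @ q \<Longrightarrow> act \<omega> u = act \<omega> w \<and> p = q"
proof (induction j arbitrary: \<omega> u w p q)
  case 0
  have "map Inl u @ Inr False # p = map Inl w @ Inr False # q \<Longrightarrow> u = w \<and> p = q"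
    for u w :: "letter list" and p q :: "(letter + bool) list"
  proof (induction u arbitrary: w)
    case Nil
    then show ?case by (cases w) auto
  next
    case (Cons s u)
    then show ?case by (cases w) auto
  qed
  with 0 show ?case by auto
next
  case (Suc j)
  let ?u = "reduce u" and ?w = "reduce w"
  have swaps: "swaps ?u = swaps ?w"
    using Suc.prems by simp
  have "act (shift \<omega>) (sec (\<omega> 0) ?u False) = act (shift \<omega>) (sec (\<omega> 0) ?w False) \<and>
      encode j (shift \<omega>) (sec (\<omega> 0) ?u True) @ p = encode j (shift \<omega>) (sec (\<omega> 0) ?w True) @ q"
    using Suc.prems by (intro Suc.IH) simp
  moreover from this have "act (shift \<omega>) (sec (\<omega> 0) ?u True) = act (shift \<omega>) (sec (\<omega> 0) ?w True) \<and> p = q"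
    by (intro Suc.IH) simp
  ultimately have sec: "act (shift \<omega>) (sec (\<omega> 0) ?u x) = act (shift \<omega>) (sec (\<omega> 0) ?w x)" and "p = q" for x
    by (cases x; simp)+
  have "act \<omega> ?u v = act \<omega> ?w v" for v
    using swaps sec by (cases v) auto
  then show ?case
    using \<open>p = q\<close> by (simp add: act_reduce fun_eq_iff)
qed

text \<open>A split doubles the constant, adds 1 for the swap bit and at most 7 from the weights.
  The form \<open>9 * 2 ^ j - 8\<close> is stable under this, as \<open>1 - 16 + 7 = - 8\<close>,
  and its value 1 at \<open>j = 0\<close> pays for the terminator.\<close>

lemma length_encode_rot:
  assumes "\<And>i. i < j \<Longrightarrow> \<omega> i"
  shows "real (length (encode j \<omega> w)) \<le> (5 / 6) ^ j * weights w + 9 * 2 ^ j - 8"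
  using assms
proof (induction j arbitrary: \<omega> w)
  case 0
  have "length w \<le> weights w"
  proof (induction w)
    case (Cons s w)
    then show ?case by (cases s) auto
  qed simp
  then show ?case by simp
next
  case (Suc j)
  let ?w = "reduce w"
  let ?u = "sec True ?w False" and ?v = "sec True ?w True"
  have "\<omega> 0"
    using Suc.prems by simp
  have "real (length (encode j (shift \<omega>) z)) \<le> (5 / 6) ^ j * weights z + 9 * 2 ^ j - 8" for z
    using Suc.prems by (intro Suc.IH) simp
  from this[of ?u] this[of ?v]
  have "real (length (encode (Suc j) \<omega> w)) \<le> (5 / 6) ^ j * (weights ?u + weights ?v) + 9 * 2 ^ Suc j - 15"
    using \<open>\<omega> 0\<close> by (simp add: algebra_simps)
  moreover have "(5 / 6) ^ j * real (weights ?u + weights ?v) \<le> (5 / 6) ^ j * (5 / 6 * (weights w + 7))"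
    using weights_sec_rot[OF alternating_reduce, of w] weights_reduce[of w]
    by (intro mult_left_mono) auto
  moreover have "(5 / 6) ^ j * (5 / 6 * real (weights w + 7)) = (5 / 6) ^ Suc j * weights w + 7 * (5 / 6) ^ Suc j"
    by (simp add: algebra_simps)
  moreover have "(5 / 6 :: real) ^ Suc j \<le> 1"
    by (rule power_le_one) auto
  ultimately show ?case
    by linarith
qed

text \<open>The first \<open>k\<close> levels need not contract, but each split there adds at most 7
  to the total weight, which the same constant absorbs.\<close>

lemma length_encode:
  assumes "\<And>i. k \<le> i \<Longrightarrow> i < k + j \<Longrightarrow> \<omega> i"
  shows "real (length (encode (k + j) \<omega> w)) \<le> (5 / 6) ^ j * weights w + 9 * 2 ^ (k + j) - 8"
  using assms
proof (induction k arbitrary: \<omega> w)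
  case 0
  then show ?case
    using length_encode_rot[of j \<omega> w] by simp
next
  case (Suc k)
  let ?w = "reduce w"
  let ?u = "sec (\<omega> 0) ?w False" and ?v = "sec (\<omega> 0) ?w True"
  have "real (length (encode (k + j) (shift \<omega>) z)) \<le> (5 / 6) ^ j * weights z + 9 * 2 ^ (k + j) - 8" for z
    using Suc.prems by (intro Suc.IH) simp
  from this[of ?u] this[of ?v]
  have "real (length (encode (Suc k + j) \<omega> w)) \<le> (5 / 6) ^ j * (weights ?u + weights ?v) + 9 * 2 ^ (Suc k + j) - 15"
    by (simp add: algebra_simps)
  moreover have "(5 / 6) ^ j * real (weights ?u + weights ?v) \<le> (5 / 6) ^ j * (weights w + 7)"
    using weights_sec[OF alternating_reduce, of "\<omega> 0" w] weights_reduce[of w]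
    by (intro mult_left_mono) auto
  moreover have "(5 / 6) ^ j * real (weights w + 7) = (5 / 6) ^ j * weights w + 7 * (5 / 6) ^ j"
    by (simp add: algebra_simps)
  moreover have "(5 / 6 :: real) ^ j \<le> 1"
    by (rule power_le_one) auto
  ultimately show ?case
    by linarith
qed

section \<open>Counting codes\<close>

lemma card_codes_le: "card {c :: (letter + bool) list. length c \<le> n} \<le> 7 ^ n"
proof -
  have card: "card (UNIV :: (letter + bool) set) = 6"
    by (simp flip: UNIV_Plus_UNIV add: card_Plus UNIV_letter card_UNIV_bool)
  have "card {c :: (letter + bool) list. length c \<le> n} = (\<Sum>i\<le>n. 6 ^ i)"
    using card_lists_length_le[of "UNIV :: (letter + bool) set" n] by (simp add: card)
  also have "\<dots> \<le> 7 ^ n"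
  proof (induction n)
    case (Suc n)
    then show ?case
      using power_mono[of 6 "7 :: nat" n] by simp
  qed simp
  finally show ?thesis .
qed

lemma card_ball_le:
  assumes "\<And>i. k \<le> i \<Longrightarrow> i < k + j \<Longrightarrow> \<omega> i" and "real n \<le> (12 / 5) ^ j"
  shows "card (ball \<omega> n) \<le> 7 ^ (17 * 2 ^ (k + j))"
proof -
  let ?W = "{w :: letter list. length w \<le> n}"
  let ?codes = "{c :: (letter + bool) list. length c \<le> 17 * 2 ^ (k + j)}"
  have fin: "finite ?codes"
    using finite_lists_length_le[of "UNIV :: (letter + bool) set" "17 * 2 ^ (k + j)"] by simp
  have "encode (k + j) \<omega> w \<in> ?codes" if "w \<in> ?W" for w
  proof -
    have "weights w \<le> 8 * length w"
    proof (induction w)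
      case (Cons s w)
      then show ?case by (cases s) auto
    qed simp
    then have "real (weights w) \<le> 8 * (12 / 5) ^ j"
      using that assms(2) by simp
    then have "(5 / 6) ^ j * real (weights w) \<le> (5 / 6) ^ j * (8 * (12 / 5) ^ j)"
      by (intro mult_left_mono) auto
    \<comment> \<open>As \<open>5 / 6 * (12 / 5) = 2\<close>, the contracted weight is comparable to
      the number of leaves; with the term 9 from \<open>length_encode\<close> this gives
      \<open>17 = 8 + 9\<close>.\<close>
    also have "\<dots> = 8 * 2 ^ j"
      by (simp flip: power_mult_distrib add: mult.left_commute)
    also have "\<dots> \<le> 8 * 2 ^ (k + j)"
      by simp
    finally have "real (length (encode (k + j) \<omega> w)) \<le> real (17 * 2 ^ (k + j))"
      using length_encode[of k j \<omega> w, OF assms(1)] by simp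
    then show ?thesis
      unfolding of_nat_le_iff by simp
  qed
  then have sub: "encode (k + j) \<omega> ` ?W \<subseteq> ?codes"
    by blast
  have "ball \<omega> n \<subseteq> (\<lambda>c. act \<omega> (inv_into ?W (encode (k + j) \<omega>) c)) ` encode (k + j) \<omega> ` ?W"
  proof
    fix g assume "g \<in> ball \<omega> n"
    then obtain w where w: "w \<in> ?W" "g = act \<omega> w"
      by (auto simp: ball_def)
    let ?w = "inv_into ?W (encode (k + j) \<omega>) (encode (k + j) \<omega> w)"
    have "encode (k + j) \<omega> ?w = encode (k + j) \<omega> w"
      using w by (intro f_inv_into_f) blast
    then have "act \<omega> ?w = g"
      using encode_append_eqD[of "k + j" \<omega> ?w "[]" w "[]"] w by simp
    with w(1) show "g \<in> (\<lambda>c. act \<omega> (inv_into ?W (encode (k + j) \<omega>) c)) ` encode (k + j) \<omega> ` ?W"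
      unfolding image_image by (intro image_eqI[of _ _ w]) simp_all
  qed
  then have "card (ball \<omega> n) \<le> card (encode (k + j) \<omega> ` ?W)"
    using finite_words by (intro surj_card_le) auto
  also have "\<dots> \<le> card ?codes"
    using fin sub by (rule card_mono)
  also have "\<dots> \<le> 7 ^ (17 * 2 ^ (k + j))"
    by (rule card_codes_le)
  finally show ?thesis .
qed

section \<open>Lower bound: stretches of the identity\<close>

text \<open>Lifts a letter to a word whose section at \<open>True\<close> is that letter. Single
  letters have \<open>A\<close> as a section only at \<open>False\<close>, hence the conjugate
  \<open>[A, B, A]\<close>, whose length is the factor 3 lost per level.\<close>

definition unrotate :: "bool \<Rightarrow> letter \<Rightarrow> letter list" where
  "unrotate r s = (if s = A then [A, B, A] else [if r then unrot s else s])"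

lemma sec_lift:
  "sec r (concat (map (unrotate r) w)) True = w \<and> \<not> swaps (concat (map (unrotate r) w))"
proof (induction w)
  case (Cons s w)
  then show ?case
    by (cases s) (auto simp: unrotate_def letter_section_def)
qed simp

lemma length_lift: "length (concat (map (unrotate r) w)) \<le> 3 * length w"
  by (induction w) (auto simp: unrotate_def)

lemma finite_ball: "finite (ball \<omega> n)"
  by (simp add: ball_def finite_words)

lemma card_ball_shift: "card (ball (shift \<omega>) n) \<le> card (ball \<omega> (3 * n))"
proof -
  have "ball (shift \<omega>) n \<subseteq> (\<lambda>g v. tl (g (True # v))) ` ball \<omega> (3 * n)"
  proof
    fix g assume "g \<in> ball (shift \<omega>) n"
    then obtain w where w: "length w \<le> n" "g = act (shift \<omega>) w"
      by (auto simp: ball_def)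
    let ?w = "concat (map (unrotate (\<omega> 0)) w)"
    have "g = (\<lambda>v. tl (act \<omega> ?w (True # v)))"
      using sec_lift[of "\<omega> 0" w] w by simp
    moreover have "act \<omega> ?w \<in> ball \<omega> (3 * n)"
      using length_lift[of "\<omega> 0" w] w by (auto simp: ball_def)
    ultimately show "g \<in> (\<lambda>g v. tl (g (True # v))) ` ball \<omega> (3 * n)"
      by blast
  qed
  then show ?thesis
    by (rule surj_card_le[OF finite_ball])
qed

lemma card_ball_shift_iterate:
  "card (ball (\<lambda>i. \<omega> (k + i)) n) \<le> card (ball \<omega> (3 ^ k * n))"
proof (induction k arbitrary: \<omega>)
  case (Suc k)
  show ?case
    using Suc[of "shift \<omega>"] card_ball_shift[of \<omega> "3 ^ k * n"] by (simp add: mult.assoc)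
qed simp

section \<open>Zigzag words and their sections\<close>

primrec zigzag :: "bool list \<Rightarrow> letter list" where
  "zigzag [] = []"
| "zigzag (x # xs) = A # (if x then B else C) # zigzag xs"

fun odds :: "'a list \<Rightarrow> 'a list" where
  "odds (x # y # zs) = x # odds zs"
| "odds zs = []"

fun evens :: "'a list \<Rightarrow> 'a list" where
  "evens (x # y # zs) = y # evens zs"
| "evens zs = []"

lemma length_zigzag: "length (zigzag xs) = 2 * length xs"
  by (induction xs) auto

lemma swaps_zigzag: "even (length xs) \<Longrightarrow> \<not> swaps (zigzag xs)"
  by (induction xs rule: odds.induct) auto

text \<open>In a block \<open>A y A y'\<close> the section at \<open>True\<close> keeps
  \<open>y'\<close> and turns \<open>y\<close> into \<open>A\<close>, which is the
  \<open>False\<close>-section of both \<open>B\<close> and \<open>C\<close>.\<close>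

lemma sec_zigzag_True:
  "even (length xs) \<Longrightarrow> sec False (zigzag xs) True = zigzag (evens xs)"
  by (induction xs rule: evens.induct) (auto simp: letter_section_def swaps_zigzag)

text \<open>Here \<open>y\<close> survives and \<open>y'\<close> becomes \<open>A\<close>, so a
  block yields \<open>y A\<close> instead of \<open>A y\<close>; the outer letters \<open>A\<close>
  correct this shift.\<close>

lemma sec_zigzag_False:
  "even (length xs) \<Longrightarrow> A # sec False (zigzag xs) False = zigzag (odds xs) @ [A]"
  by (induction xs rule: odds.induct) (auto simp: letter_section_def swaps_zigzag)

lemma odds_evens_inject:
  "length xs = length ys \<Longrightarrow> even (length xs) \<Longrightarrow> odds xs = odds ys \<Longrightarrow> evens xs = evens ys \<Longrightarrow> xs = ys"
proof (induction xs arbitrary: ys rule: odds.induct)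
  case (1 x y zs)
  then obtain x' y' zs' where "ys = x' # y' # zs'"
    by (metis length_Suc_conv list.size(4) add_Suc_right)
  with 1 show ?case by auto
qed auto

lemma length_odds_evens:
  "length (odds xs) = length xs div 2" "length (evens xs) = length xs div 2"
  by (induction xs rule: odds.induct) auto

text \<open>As long as \<open>\<omega>\<close> is false, \<open>D\<close> acts only deep in the tree, so that \<open>B\<close> and \<open>C = B D\<close> can
  be chosen freely at \<open>2 ^ m\<close> places; the first true entry of \<open>\<omega>\<close> makes \<open>D\<close> act
  nontrivially and distinguishes the choices.\<close>

lemma zigzag_inject:
  assumes "\<And>i. i < m \<Longrightarrow> \<not> \<omega> i" and "\<omega> m"
    and "length xs = 2 ^ m" and "length ys = 2 ^ m"
    and "act \<omega> (zigzag xs) = act \<omega> (zigzag ys)"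
  shows "xs = ys"
  using assms
proof (induction m arbitrary: \<omega> xs ys)
  case 0
  then obtain x y where "xs = [x]" "ys = [y]"
    by (auto simp: length_Suc_conv)
  \<comment> \<open>The rotation turns the choice between \<open>B\<close> and \<open>C\<close> into
    one between \<open>C\<close> and \<open>D\<close>, whose \<open>False\<close>-sections are
    \<open>A\<close> and trivial; the last bit of this vertex shows the difference.\<close>
  moreover have "act \<omega> (zigzag xs) [True, False, True] = act \<omega> (zigzag ys) [True, False, True]"
    using 0 by simp
  ultimately show ?case
    using \<open>\<omega> 0\<close> by (cases x; cases y; cases "\<omega> (Suc 0)") (auto simp: letter_section_def)
next
  case (Suc m)
  have even: "even (length xs)" "even (length ys)"
    using Suc.prems by auto
  have "\<not> \<omega> 0"
    using Suc.prems(1) by simp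
  have sec: "act (shift \<omega>) (sec False (zigzag xs) x) v = act (shift \<omega>) (sec False (zigzag ys) x) v" for x v
    using fun_cong[OF Suc.prems(5), of "x # v"] \<open>\<not> \<omega> 0\<close> by simp
  have "act (shift \<omega>) (zigzag (evens xs)) = act (shift \<omega>) (zigzag (evens ys))"
    using sec[of True] by (simp add: sec_zigzag_True even fun_eq_iff)
  then have "evens xs = evens ys"
    using Suc.prems by (intro Suc.IH[of "shift \<omega>"]) (auto simp: length_odds_evens)
  \<comment> \<open>Up to conjugation by \<open>A\<close>, the section at \<open>False\<close> is
    the zigzag word of the odd places.\<close>
  have "act (shift \<omega>) (zigzag (odds xs)) v = act (shift \<omega>) (zigzag (odds ys)) v" for v
  proof -
    have "act (shift \<omega>) (zigzag (odds zs)) v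
        = act (shift \<omega>) [A] (act (shift \<omega>) (sec False (zigzag zs) False) (act (shift \<omega>) [A] v))"
      if "even (length zs)" for zs
    proof -
      have "act (shift \<omega>) (zigzag (odds zs)) v = act (shift \<omega>) (zigzag (odds zs)) (act (shift \<omega>) [A, A] v)"
        by (simp only: act_double)
      also have "\<dots> = act (shift \<omega>) (zigzag (odds zs) @ [A]) (act (shift \<omega>) [A] v)"
        by (simp only: act_append[symmetric] append.simps append_assoc)
      also have "zigzag (odds zs) @ [A] = [A] @ sec False (zigzag zs) False"
        using sec_zigzag_False[OF that] by simp
      finally show ?thesis
        by (simp only: act_append)
    qed
    with even show ?thesis
      by (simp only: sec)
  qed
  then have "odds xs = odds ys"
    using Suc.prems by (intro Suc.IH[of "shift \<omega>"]) (auto simp: length_odds_evens)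
  with \<open>evens xs = evens ys\<close> show ?case
    using odds_evens_inject even Suc.prems by metis
qed

text \<open>The \<open>2 ^ m\<close> binary choices in a zigzag word give distinct elements
  \<open>k\<close> levels down; lifting them to the root costs the factor
  \<open>3 ^ k\<close>.\<close>

lemma card_ball_ge:
  assumes "\<And>i. k \<le> i \<Longrightarrow> i < k + m \<Longrightarrow> \<not> \<omega> i" and "\<omega> (k + m)"
  shows "2 ^ 2 ^ m \<le> card (ball \<omega> (3 ^ k * (2 * 2 ^ m)))"
proof -
  let ?\<omega> = "\<lambda>i. \<omega> (k + i)"
  let ?X = "{xs :: bool list. length xs = 2 ^ m}"
  have "card ?X = 2 ^ 2 ^ m"
    using card_lists_length_eq[of "UNIV :: bool set" "2 ^ m"] by (simp add: card_UNIV_bool)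
  moreover have "inj_on (\<lambda>xs. act ?\<omega> (zigzag xs)) ?X"
    using assms by (intro inj_onI) (auto intro!: zigzag_inject[of m ?\<omega>])
  moreover have "(\<lambda>xs. act ?\<omega> (zigzag xs)) ` ?X \<subseteq> ball ?\<omega> (2 * 2 ^ m)"
    by (auto simp: ball_def length_zigzag)
  ultimately have "2 ^ 2 ^ m \<le> card (ball ?\<omega> (2 * 2 ^ m))"
    by (metis card_inj_on_le finite_ball)
  also have "\<dots> \<le> card (ball \<omega> (3 ^ k * (2 * 2 ^ m)))"
    by (rule card_ball_shift_iterate)
  finally show ?thesis .
qed

section \<open>Oscillation\<close>

lemma filterlim_power_at_top:
  fixes x :: real
  assumes "1 < x"
  shows "filterlim (\<lambda>n. x ^ n) at_top sequentially"
  using assms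
  by (intro filterlim_at_infinity_imp_filterlim_at_top filterlim_realpow_sequentially_gt1) auto

lemma eventually_slow:
  fixes k :: nat
  defines "N \<equiv> \<lambda>j. nat \<lfloor>(12 / 5 :: real) ^ j\<rfloor>"
  shows "\<forall>\<^sub>F j in sequentially. k \<le> N j \<and> 7 ^ (17 * 2 ^ (k + j)) < exp (real (N j) powr (4 / 5))"
proof -
  define \<theta> :: real where "\<theta> = (12 / 5) powr (4 / 5)"
  \<comment> \<open>Rounding down a number that is at least 1 loses at most a factor 2.\<close>
  have N_ge: "(12 / 5) ^ j / 2 \<le> real (N j)" for j
  proof -
    have half: "x / 2 \<le> real (nat \<lfloor>x\<rfloor>)" if "1 \<le> x" for x :: real
    proof -
      have "1 \<le> nat \<lfloor>x\<rfloor>"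
        using that by (simp add: le_nat_floor)
      then have "1 \<le> real (nat \<lfloor>x\<rfloor>)"
        using of_nat_mono by fastforce
      moreover have "x < real_of_int \<lfloor>x\<rfloor> + 1"
        by (rule real_of_int_floor_add_one_gt)
      then have "x < real (nat \<lfloor>x\<rfloor>) + 1"
        using that by simp
      ultimately show ?thesis
        by argo
    qed
    show ?thesis
      unfolding N_def by (rule half, rule one_le_power) simp
  qed
  have "\<theta> ^ 5 = (12 / 5) ^ 4"
    unfolding \<theta>_def by (simp add: powr_power)
  \<comment> \<open>The exponent 4/5 is decisive here: \<open>(12 / 5) ^ 4 = 33.1776\<close> just
    exceeds \<open>2 ^ 5 = 32\<close>.\<close>
  then have "2 ^ 5 < \<theta> ^ 5"
    by (simp add: power_divide)
  then have "2 < \<theta>"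
    by (rule power_less_imp_less_base) (simp add: \<theta>_def)
  have pow: "\<theta> ^ j / 2 \<le> real (N j) powr (4 / 5)" for j
  proof -
    have "\<theta> ^ j = ((12 / 5) powr real j) powr (4 / 5)"
      unfolding \<theta>_def by (simp only: powr_power powr_powr)
    also have "(12 / 5) powr real j = (12 / 5 :: real) ^ j"
      by (rule powr_realpow) simp
    finally have \<theta>_power: "\<theta> ^ j = ((12 / 5) ^ j) powr (4 / 5)" .
    have "\<theta> ^ j / 2 \<le> \<theta> ^ j / 2 powr (4 / 5)"
      using powr_mono[of "4 / 5" 1 "2 :: real"] \<open>2 < \<theta>\<close> by (intro divide_left_mono) auto
    also have "\<dots> = ((12 / 5) ^ j / 2) powr (4 / 5)"
      unfolding \<theta>_power by (rule powr_divide[symmetric])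
    also have "\<dots> \<le> real (N j) powr (4 / 5)"
      using N_ge by (intro powr_mono2) auto
    finally show ?thesis .
  qed
  have "filterlim (\<lambda>j. (\<theta> / 2) ^ j) at_top sequentially"
    using \<open>2 < \<theta>\<close> by (intro filterlim_power_at_top) auto
  \<comment> \<open>The leading 2 makes up for the rounding loss in \<open>pow\<close>.\<close>
  then have "\<forall>\<^sub>F j in sequentially. 2 * (17 * 2 ^ k * ln 7) < (\<theta> / 2) ^ j"
    by (auto simp: filterlim_at_top_dense)
  moreover have "filterlim (\<lambda>j. (12 / 5 :: real) ^ j) at_top sequentially"
    by (intro filterlim_power_at_top) auto
  then have "\<forall>\<^sub>F j in sequentially. 2 * real k \<le> (12 / 5) ^ j"
    by (auto simp: filterlim_at_top)
  ultimately show ?thesis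
  proof eventually_elim
    case (elim j)
    have "2 * (17 * 2 ^ k * ln 7) * 2 ^ j < \<theta> ^ j"
      using elim(1) by (simp add: power_divide pos_less_divide_eq)
    moreover have "real (17 * 2 ^ (k + j)) * ln 7 = 2 * (17 * 2 ^ k * ln 7) * 2 ^ j / 2"
      by (simp add: power_add)
    ultimately have "real (17 * 2 ^ (k + j)) * ln 7 < real (N j) powr (4 / 5)"
      using pow[of j] by linarith
    then have "exp (real (17 * 2 ^ (k + j)) * ln 7) < exp (real (N j) powr (4 / 5))"
      by simp
    also have "exp (real (17 * 2 ^ (k + j)) * ln 7) = 7 ^ (17 * 2 ^ (k + j))"
      by (simp only: exp_of_nat_mult) simp
    finally show ?case
      using elim(2) N_ge[of j] by simp
  qed
qed

lemma eventually_fast: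
  fixes \<mu> :: "nat \<Rightarrow> real"
  assumes "\<mu> \<in> o(\<lambda>n. real n)"
  shows "\<forall>\<^sub>F m in sequentially. exp (\<mu> (3 ^ k * (2 * 2 ^ m))) < 2 ^ 2 ^ m"
proof -
  \<comment> \<open>At \<open>n = 3 ^ k * (2 * 2 ^ m)\<close> the bound \<open>c * n\<close> is half
    the logarithm of \<open>2 ^ 2 ^ m\<close>.\<close>
  define c :: real where "c = ln 2 / (4 * 3 ^ k)"
  have "\<forall>\<^sub>F n in sequentially. norm (\<mu> n) \<le> c * norm (real n)"
    by (rule landau_o.smallD[OF assms]) (simp add: c_def)
  moreover have "filterlim (\<lambda>m. 3 ^ k * (2 * 2 ^ m) :: nat) at_top sequentially"
  proof (rule filterlim_at_top_mono[OF filterlim_ident])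
    have "m \<le> 3 ^ k * (2 * 2 ^ m)" for m :: nat
    proof -
      have "m \<le> 1 * (1 * 2 ^ m)"
        using less_exp[of m] by simp
      also have "\<dots> \<le> 3 ^ k * (2 * 2 ^ m)"
        by (intro mult_le_mono) auto
      finally show ?thesis .
    qed
    then show "\<forall>\<^sub>F m in sequentially. m \<le> 3 ^ k * (2 * 2 ^ m)"
      by simp
  qed
  ultimately have "\<forall>\<^sub>F m in sequentially.
      norm (\<mu> (3 ^ k * (2 * 2 ^ m))) \<le> c * norm (real (3 ^ k * (2 * 2 ^ m)))"
    by (rule eventually_compose_filterlim)
  then show ?thesis
  proof eventually_elim
    case (elim m)
    then have "\<mu> (3 ^ k * (2 * 2 ^ m)) \<le> ln 2 / 2 * 2 ^ m"
      by (simp add: c_def)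
    also have "\<dots> < ln 2 * 2 ^ m"
      by simp
    finally have "exp (\<mu> (3 ^ k * (2 * 2 ^ m))) < exp (real (2 ^ m) * ln 2)"
      by (simp add: mult.commute)
    also have "\<dots> = 2 ^ 2 ^ m"
      by (simp only: exp_of_nat_mult) simp
    finally show ?case .
  qed
qed

theorem corollary1p1:
  fixes \<mu> :: "nat \<Rightarrow> real"
  assumes "mono \<mu>"
    and "\<And>n. 0 \<le> \<mu> n"
    and "\<mu> \<in> o(\<lambda>n. real n)"
  shows "\<exists>(\<Gamma> :: nat monoid) S.
           group \<Gamma> \<and> finite_symmetric_generating_set \<Gamma> S \<and>
           infinite {n. real (growth \<Gamma> S n) < exp (real n powr (4 / 5))} \<and>
           infinite {n'. real (growth \<Gamma> S n') > exp (\<mu> n')}"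
proof -
  define N where "N = (\<lambda>j. nat \<lfloor>(12 / 5 :: real) ^ j\<rfloor>)"
  \<comment> \<open>One length is chosen to suit a stretch of either kind starting at
    \<open>k\<close>, so the recursion for the endpoints can ignore parity; \<open>j > 0\<close>
    keeps the stretches nonempty.\<close>
  have "\<exists>j>0. (k \<le> N j \<and> 7 ^ (17 * 2 ^ (k + j)) < exp (real (N j) powr (4 / 5))) \<and>
      exp (\<mu> (3 ^ k * (2 * 2 ^ j))) < 2 ^ 2 ^ j" for k
    using eventually_conj[OF eventually_gt_at_top[of 0]
        eventually_conj[OF eventually_slow[of k] eventually_fast[OF assms(3), of k]]]
    unfolding N_def by (auto dest: eventually_happens)
  then obtain f where f: "f k > 0" "k \<le> N (f k)"
    "7 ^ (17 * 2 ^ (k + f k)) < exp (real (N (f k)) powr (4 / 5))"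
    "exp (\<mu> (3 ^ k * (2 * 2 ^ f k))) < 2 ^ 2 ^ f k" for k
    by metis
  define t where "t = rec_nat 0 (\<lambda>_ k. k + f k)"
  have t_Suc: "t (Suc i) = t i + f (t i)" for i
    by (simp add: t_def)
  have t_mono: "strict_mono t"
    using f(1) by (simp add: strict_mono_Suc_iff t_Suc)
  define \<omega> where "\<omega> x \<longleftrightarrow> (\<exists>i. t (2 * i) \<le> x \<and> x < t (Suc (2 * i)))" for x
  have slow: "\<exists>n\<ge>i. real (card (ball \<omega> n)) < exp (real n powr (4 / 5))" for i
  proof (intro exI conjI)
    let ?k = "t (2 * i)"
    have "i \<le> ?k"
      using seq_suble[OF t_mono, of "2 * i"] by simp
    then show "i \<le> N (f ?k)"
      using f(2)[of ?k] by simp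
    have "card (ball \<omega> (N (f ?k))) \<le> 7 ^ (17 * 2 ^ (?k + f ?k))"
    proof (rule card_ball_le)
      show "\<omega> x" if "?k \<le> x" "x < ?k + f ?k" for x
        using that t_Suc[of "2 * i"] unfolding \<omega>_def by auto
      show "real (N (f ?k)) \<le> (12 / 5) ^ f ?k"
        by (simp add: N_def)
    qed
    then have "real (card (ball \<omega> (N (f ?k)))) \<le> 7 ^ (17 * 2 ^ (?k + f ?k))"
      by (metis of_nat_le_iff of_nat_numeral of_nat_power)
    also note f(3)
    finally show "real (card (ball \<omega> (N (f ?k)))) < exp (real (N (f ?k)) powr (4 / 5))" .
  qed
  have fast: "\<exists>n\<ge>i. exp (\<mu> n) < real (card (ball \<omega> n))" for i
  proof (intro exI conjI)
    let ?k = "t (Suc (2 * i))"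
    let ?n = "3 ^ ?k * (2 * 2 ^ f ?k)"
    have "i \<le> ?k"
      using seq_suble[OF t_mono, of "Suc (2 * i)"] by simp
    also have "\<dots> \<le> 3 ^ ?k * 1"
      using power_gt_expt[of 3 ?k] by simp
    also have "\<dots> \<le> ?n"
      by (intro mult_le_mono) auto
    finally show "i \<le> ?n" .
    have "2 ^ 2 ^ f ?k \<le> card (ball \<omega> ?n)"
    proof (rule card_ball_ge)
      \<comment> \<open>The next true stretch is nonempty and supplies the true entry that must end
        the false one.\<close>
      have "t (Suc (Suc (2 * i))) < t (Suc (Suc (Suc (2 * i))))"
        using t_mono by (simp add: strict_mono_less)
      then show "\<omega> (?k + f ?k)"
        unfolding \<omega>_def t_Suc[of "Suc (2 * i)", symmetric] by (intro exI[of _ "Suc i"]) simp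
      show "\<not> \<omega> x" if x: "?k \<le> x" "x < ?k + f ?k" for x
      proof
        assume "\<omega> x"
        then obtain i' where "t (2 * i') \<le> x" "x < t (Suc (2 * i'))"
          unfolding \<omega>_def by blast
        \<comment> \<open>A true stretch meeting this one would need an index with
          \<open>i < i' < i + 1\<close>.\<close>
        with x have "t (Suc (2 * i)) < t (Suc (2 * i'))" "t (2 * i') < t (Suc (Suc (2 * i)))"
          unfolding t_Suc[of "Suc (2 * i)"] by linarith+
        then have "Suc (2 * i) < Suc (2 * i')" "2 * i' < Suc (Suc (2 * i))"
          using t_mono by (simp_all only: strict_mono_less)
        then show False
          by simp
      qed
    qed
    then have "2 ^ 2 ^ f ?k \<le> real (card (ball \<omega> ?n))"
      by (metis of_nat_le_iff of_nat_numeral of_nat_power)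
    with f(4)[of ?k] show "exp (\<mu> ?n) < real (card (ball \<omega> ?n))"
      by (rule less_le_trans)
  qed
  have "infinite {n. real (growth (tree_group \<omega>) (gens \<omega>) n) < exp (real n powr (4 / 5))}"
    unfolding growth_eq_card_ball infinite_nat_iff_unbounded_le using slow by auto
  moreover have "infinite {n. real (growth (tree_group \<omega>) (gens \<omega>) n) > exp (\<mu> n)}"
    unfolding growth_eq_card_ball infinite_nat_iff_unbounded_le using fast by auto
  ultimately show ?thesis
    using group_tree_group gens_generate by blast
qed

end
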